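(* Let $\gamma_{\mathrm{ref}} \in \mathbb{R}$ and let $P_{\mathrm{ref}}$ be a probability measure on $(\mathbb{R},\mathcal{B}(\mathbb{R}))$ with distribution function $F(x) = P_{\mathrm{ref}}(-\infty,x]$ and right endpoint $x_F^* := \sup\{x : F(x) < 1\}$. Suppose that $F$ belongs to the maximum domain of attraction of $G_{\gamma_{\mathrm{ref}}}$. Suppose in addition that $F''(x)$ exists and $F'(x)$ is positive for all $x$ in some left neighborhood of $x_F^*$, and that $$\lim_{x \uparrow x_F^*} \left(\frac{1-F}{F'}\right)'(x) = \gamma_{\mathrm{ref}}.$$ For any $\alpha > 1$ and $\delta > 0$, let $$\bar F_{\alpha,\delta}(x) := \sup\{P(x,\infty) : D_\alpha(P,P_{\mathrm{ref}}) \le \delta\}, \qquad x \in \mathbb{R}, \qquad\text{and}\qquad \gamma^* := \frac{\alpha}{\alpha-1}\,\gamma_{\mathrm{ref}}.$$ Then the distribution function $F_{\alpha,\delta}(x) = 1 - \bar F_{\alpha,\delta}(x)$ belongs to the maximum domain of attraction of $G_{\gamma^*}$.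
   Context: For $\alpha>1$ and probability measures $P, Q$ on $(\mathbb{R},\mathcal{B}(\mathbb{R}))$ with $P$ absolutely continuous with respect to $Q$, the Rényi divergence of degree $\alpha$ is $D_\alpha(P,Q) := \frac{1}{\alpha-1}\log E_Q\left[\left(\frac{dP}{dQ}\right)^\alpha\right]$; if $P$ is not absolutely continuous with respect to $Q$, then $D_\alpha(P,Q) := \infty$. The supremum defining $\bar F_{\alpha,\delta}$ is over all Borel probability measures $P$ on $\mathbb{R}$. For $\gamma\in\mathbb{R}$, the extreme value distribution is $G_\gamma(x) := \exp\left(-(1+\gamma x)^{-1/\gamma}\right)$ for $1+\gamma x>0$, interpreted as $\exp(-\exp(-x))$ when $\gamma=0$ (outside $\{1+\gamma x>0\}$, $G_\gamma$ is extended as a distribution function: $0$ if $\gamma>0$, $1$ if $\gamma<0$). A distribution function $F$ belongs to the maximum domain of attraction of $G_\gamma$ (written $F\in\mathcal{D}(G_\gamma)$) if there are constants $a_n>0$, $b_n\in\mathbb{R}$ and $a>0$, $b\in\mathbb{R}$ such that $\lim_{n\to\infty}F^n(a_nx+b_n)=G_\gamma(ax+b)$ for every continuity point $x$ of the limit. Standing assumption: $P_{\mathrm{ref}}(x,\infty)\to 0$ as $x\to\sup\{x: P_{\mathrm{ref}}(x,\infty)>0\}$. *)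

theory Defs
  imports "HOL-Probability.Probability"
begin

text \<open>The integral is taken in the extended nonnegative reals, so that an infinite expectation
  yields an infinite divergence. Since \<open>P\<close> and \<open>Q\<close> are probability measures,
  \<^term>\<open>RN_deriv Q P\<close> is finite \<open>Q\<close>-almost everywhere, hence \<^const>\<open>enn2real\<close> loses nothing;
  a finite value of the integral is positive (at least 1).\<close>

definition renyi_divergence :: "real \<Rightarrow> 'a measure \<Rightarrow> 'a measure \<Rightarrow> ereal" where
  "renyi_divergence \<alpha> P Q =
    (if absolutely_continuous Q P then
       (let I = (\<integral>\<^sup>+ x. ennreal (enn2real (RN_deriv Q P x) powr \<alpha>) \<partial>Q)
        in if I = \<infinity> then \<infinity> else ereal (1 / (\<alpha> - 1) * ln (enn2real I)))
     else \<infinity>)"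

definition worst_case_tail :: "real measure \<Rightarrow> real \<Rightarrow> real \<Rightarrow> real \<Rightarrow> real" where
  "worst_case_tail Pref \<alpha> \<delta> x =
    Sup {measure P {x<..} | P. real_distribution P \<and> renyi_divergence \<alpha> P Pref \<le> ereal \<delta>}"

definition gev_cdf :: "real \<Rightarrow> real \<Rightarrow> real" where
  "gev_cdf \<gamma> x =
    (if \<gamma> = 0 then exp (- exp (- x))
     else if 1 + \<gamma> * x > 0 then exp (- ((1 + \<gamma> * x) powr (- 1 / \<gamma>)))
     else if \<gamma> > 0 then 0 else 1)"

text \<open>Only distribution functions, i.e. functions of the form \<^term>\<open>cdf M\<close>, can be members.\<close>

definition max_domain_of_attraction :: "real \<Rightarrow> (real \<Rightarrow> real) set" where
  "max_domain_of_attraction \<gamma> =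
    {F. (\<exists>M. real_distribution M \<and> F = cdf M) \<and>
        (\<exists>(a :: nat \<Rightarrow> real) (b :: nat \<Rightarrow> real) (a' :: real) (b' :: real).
           (\<forall>n. a n > 0) \<and> a' > 0 \<and>
           (\<forall>x. isCont (\<lambda>t. gev_cdf \<gamma> (a' * t + b')) x \<longrightarrow>
             (\<lambda>n. F (a n * x + b n) ^ n) \<longlonglongrightarrow> gev_cdf \<gamma> (a' * x + b')))}"

definition right_endpoint :: "(real \<Rightarrow> real) \<Rightarrow> ereal" where
  "right_endpoint F = Sup (ereal ` {x. F x < 1})"

text \<open>The filter of real numbers increasing strictly to a possibly infinite point.\<close>

definition left_of :: "ereal \<Rightarrow> real filter" where
  "left_of e = filtercomap ereal (at_left e)"

lemma eventually_left_of:
  assumes "e \<noteq> -\<infinity>"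
  shows "eventually P (left_of e) \<longleftrightarrow> (\<exists>u. ereal u < e \<and> (\<forall>x. u < x \<and> ereal x < e \<longrightarrow> P x))"
proof
  have bot: "- \<infinity> < e" using assms by (cases e) auto
  assume "eventually P (left_of e)"
  then obtain Q where Q: "eventually Q (at_left e)" "\<And>x. Q (ereal x) \<Longrightarrow> P x"
    by (auto simp: left_of_def eventually_filtercomap)
  obtain c where c: "c < e" "\<And>y. c < y \<Longrightarrow> y < e \<Longrightarrow> Q y"
    using Q(1) eventually_at_left[OF bot] by blast
  obtain u where "c < ereal u" "ereal u < e" using ereal_dense2[OF c(1)] by blast
  then show "\<exists>u. ereal u < e \<and> (\<forall>x. u < x \<and> ereal x < e \<longrightarrow> P x)"
    using c(2) Q(2) by (meson less_ereal.simps(1) less_trans)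
next
  have bot: "- \<infinity> < e" using assms by (cases e) auto
  assume "\<exists>u. ereal u < e \<and> (\<forall>x. u < x \<and> ereal x < e \<longrightarrow> P x)"
  then obtain u where u: "ereal u < e" "\<And>x. u < x \<Longrightarrow> ereal x < e \<Longrightarrow> P x" by blast
  then have "eventually (\<lambda>y. ereal u < y \<and> y < e) (at_left e)"
    using eventually_at_left[OF bot] by blast
  then show "eventually P (left_of e)"
    unfolding left_of_def eventually_filtercomap using u(2) by fastforce
qed

end

theory Submission
  imports Defs "HOL-Real_Asymp.Real_Asymp"
begin

text \<open>
  Let \<open>p = Pref(x, \<infinity>)\<close>, let \<open>W\<close> be the worst-case tail, and put \<open>C = exp ((\<alpha> - 1) \<delta>) > 1\<close>,
  \<open>\<beta> = (\<alpha> - 1) / \<alpha>\<close> and \<open>K = (C - 1) powr (1 / \<alpha>)\<close>.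

  The heart of the matter is the equivalence \<open>W \<sim> K p powr \<beta>\<close> as \<open>p\<close> tends to \<open>0\<close>. Among all
  measures that give an event of reference probability \<open>p\<close> the probability \<open>q\<close>, the divergence is
  least for the one whose density is constant on the event and on its complement, where the
  constraint reads \<open>q powr \<alpha> * p powr (1 - \<alpha>) + (1 - q) powr \<alpha> * (1 - p) powr (1 - \<alpha>) \<le> C\<close>.
  When \<open>p\<close> is small, so is \<open>q\<close>, the second summand is close to \<open>1\<close>, and the largest admissible \<open>q\<close> is
  therefore close to \<open>K p powr \<beta>\<close>. The upper bound \<open>renyi_divergence_le_imp_event_bound\<close> follows
  by integrating tangent lines of \<open>t powr \<alpha>\<close>, and the lower bound by exhibiting the two-valued
  density (\<open>two_valued_density\<close>); \<open>tendsto_ratio\<close> combines them.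

  The domain of attraction is then transferred directly. Convergence of \<open>F (a\<^sub>k y + b\<^sub>k) ^ k\<close> to
  \<open>exp (-\<tau>)\<close> says that \<open>k p\<^sub>k\<close> converges to \<open>\<tau>\<close>, where \<open>p\<^sub>k\<close> is the reference tail at
  \<open>a\<^sub>k y + b\<^sub>k\<close>. Choosing indices \<open>m(n)\<close> with \<open>m(n) powr \<beta> \<sim> K n\<close> makes
  \<open>n K p\<^bsub>m(n)\<^esub> powr \<beta>\<close> converge to \<open>\<tau> powr \<beta>\<close>, so that the \<open>n\<close>-th powers of
  \<open>1 - W\<close>, with the norming constants of index \<open>m(n)\<close>, converge to \<open>exp (- (\<tau> powr \<beta>))\<close>
  (\<open>worst_case_powers_tendsto\<close>). Raising \<open>\<tau> = (1 + \<gamma> y) powr (- 1 / \<gamma>)\<close> to the power \<open>\<beta>\<close> turns the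
  extreme value distribution of index \<open>\<gamma>\<close> at \<open>y\<close> into the one of index \<open>\<gamma> / \<beta>\<close> at \<open>\<beta> y\<close>
  (\<open>gev_cdf_cases\<close>), and \<open>\<gamma> / \<beta> = \<alpha> / (\<alpha> - 1) * \<gamma>\<close>.
\<close>

section \<open>Event probabilities under a bound on the Renyi divergence\<close>

lemma powr_above_tangent:
  fixes a c t :: real
  assumes "a > 1" "c \<ge> 0" "t \<ge> 0"
  shows "c powr a + a * c powr (a - 1) * (t - c) \<le> t powr a"
proof -
  consider "c = 0" | "t = 0" "c > 0" | "c > 0" "t > 0"
    using assms by linarith
  then show ?thesis
  proof cases
    case 1
    then show ?thesis using assms by simp
  next
    case 2
    have "c powr (a - 1) * c = c powr a"
      using 2 by (simp add: powr_mult_base mult.commute)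
    moreover have "c powr a \<le> a * c powr a"
      using mult_right_mono[of 1 a "c powr a"] assms by simp
    ultimately show ?thesis using 2 assms by (simp add: mult.assoc)
  next
    case 3
    have "t powr a - c powr a \<ge> a * c powr (a - 1) * (t - c)"
    proof (rule convex_on_imp_above_tangent[where A = "{0<..}"])
      show "convex_on {0<..} (\<lambda>t::real. t powr a)"
        using assms powr_convex by auto
      show "((\<lambda>t. t powr a) has_real_derivative a * c powr (a - 1)) (at c within {0<..})"
        using 3 by (auto intro!: derivative_eq_intros simp: powr_diff)
    qed (use 3 in \<open>auto simp: interior_open\<close>)
    then show ?thesis by simp
  qed
qed

lemma renyi_divergence_density:
  fixes f :: "'a \<Rightarrow> real"
  assumes "prob_space Q" and [measurable]: "f \<in> borel_measurable Q"
    and f: "\<And>x. f x \<ge> 0"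
    and E: "(\<integral>\<^sup>+x. ennreal (f x powr \<alpha>) \<partial>Q) = ennreal E" "E \<ge> 0"
  shows "renyi_divergence \<alpha> (density Q (\<lambda>x. ennreal (f x))) Q = ereal (1 / (\<alpha> - 1) * ln E)"
proof -
  interpret prob_space Q by fact
  have "AE x in Q. ennreal (f x) = RN_deriv Q (density Q (\<lambda>x. ennreal (f x))) x"
    by (rule RN_deriv_unique) auto
  then have "(\<integral>\<^sup>+x. ennreal (enn2real (RN_deriv Q (density Q (\<lambda>x. ennreal (f x))) x) powr \<alpha>) \<partial>Q)
      = (\<integral>\<^sup>+x. ennreal (f x powr \<alpha>) \<partial>Q)"
  proof (intro nn_integral_cong_AE, eventually_elim)
    case (elim x)
    then show ?case using f[of x] by (metis enn2real_ennreal)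
  qed
  then show ?thesis
    unfolding renyi_divergence_def using E
    by (simp add: absolutely_continuousI_density)
qed

text \<open>A bound on the divergence limits how much the probability of a single event can grow. In terms of
  \<open>p = measure Q A\<close> and \<open>q = measure P A\<close>, this is the two-cell inequality
  \<open>q powr \<alpha> * p powr (1 - \<alpha>) + (1 - \<alpha> q) \<le> exp ((\<alpha> - 1) \<delta>)\<close>, in which the contribution
  of the complement is weakened to \<open>1 - \<alpha> q\<close>; the form below also covers \<open>p = 0\<close>.\<close>

lemma renyi_divergence_le_imp_event_bound:
  assumes "prob_space P" "prob_space Q" and sets_eq: "sets P = sets Q" and A: "A \<in> sets Q"
    and \<alpha>: "\<alpha> > 1" and le: "renyi_divergence \<alpha> P Q \<le> ereal \<delta>"
  shows "measure P A powr \<alpha>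
    \<le> (exp ((\<alpha> - 1) * \<delta>) - 1 + \<alpha> * measure P A) * measure Q A powr (\<alpha> - 1)"
proof -
  interpret P: prob_space P by fact
  interpret Q: prob_space Q by fact
  define f where "f x = enn2real (RN_deriv Q P x)" for x
  define J where "J = (\<integral>\<^sup>+x. ennreal (f x powr \<alpha>) \<partial>Q)"
  define p where "p = measure Q A"
  define q where "q = measure P A"
  note [measurable] = A
  have f_meas[measurable]: "f \<in> borel_measurable Q" unfolding f_def by measurable
  have f_nonneg: "f x \<ge> 0" for x unfolding f_def by simp
  have ac: "absolutely_continuous Q P"
    using le unfolding renyi_divergence_def by (auto split: if_splits)
  have J_fin: "J \<noteq> \<infinity>" and J_ln: "1 / (\<alpha> - 1) * ln (enn2real J) \<le> \<delta>"
    using le ac unfolding renyi_divergence_def J_def f_def Let_def by (auto split: if_splits)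
  have "ln (enn2real J) \<le> (\<alpha> - 1) * \<delta>"
    using J_ln \<alpha> by (simp add: field_simps)
  then have J_le: "enn2real J \<le> exp ((\<alpha> - 1) * \<delta>)"
    by (metis exp_ge_zero exp_le_cancel_iff exp_ln le_less enn2real_nonneg)
  have int_f\<alpha>: "integrable Q (\<lambda>x. f x powr \<alpha>)"
    by (rule integrableI_nonneg) (use J_fin in \<open>auto simp: J_def less_top\<close>)
  have int_J: "(\<integral>x. f x powr \<alpha> \<partial>Q) = enn2real J"
    unfolding J_def by (rule integral_eq_nn_integral) auto
  have P_eq: "P = density Q (\<lambda>x. ennreal (f x))"
  proof -
    have "AE x in Q. RN_deriv Q P x \<noteq> \<infinity>"
      by (rule Q.RN_deriv_finite) (use ac sets_eq in \<open>auto intro: P.sigma_finite_measure_axioms\<close>)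
    then have "density Q (\<lambda>x. ennreal (f x)) = density Q (RN_deriv Q P)"
      by (intro density_cong) (auto simp: f_def less_top)
    then show ?thesis using Q.density_RN_deriv[OF ac sets_eq] by simp
  qed
  have int_f: "integrable Q f"
  proof (rule integrableI_nonneg)
    have "(\<integral>\<^sup>+x. ennreal (f x) \<partial>Q) = emeasure (density Q (\<lambda>x. ennreal (f x))) (space Q)"
      by (subst emeasure_density) (auto intro!: nn_integral_cong)
    also have "\<dots> = 1"
      using P.emeasure_space_1 P_eq sets_eq_imp_space_eq[OF sets_eq] by simp
    finally show "(\<integral>\<^sup>+x. ennreal (f x) \<partial>Q) < \<infinity>" by simp
  qed (use f_nonneg in auto)
  have f_set: "(\<integral>x. f x * indicator B x \<partial>Q) = measure P B" if [measurable]: "B \<in> sets Q" for B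
  proof -
    have "(\<integral>x. f x * indicator B x \<partial>Q) = enn2real (\<integral>\<^sup>+x. ennreal (f x * indicator B x) \<partial>Q)"
      using f_nonneg by (intro integral_eq_nn_integral) auto
    also have "(\<integral>\<^sup>+x. ennreal (f x * indicator B x) \<partial>Q)
        = (\<integral>\<^sup>+x. ennreal (f x) * indicator B x \<partial>Q)"
      by (intro nn_integral_cong) (auto split: split_indicator)
    also have "\<dots> = emeasure P B"
      by (subst P_eq, subst emeasure_density) auto
    finally show ?thesis by (simp add: measure_def)
  qed
  show ?thesis
  proof (cases "p = 0")
    case True
    then have "A \<in> null_sets Q"
      unfolding p_def using A by (auto simp: Q.emeasure_eq_measure null_sets_def)
    then have "A \<in> null_sets P" using ac unfolding absolutely_continuous_def by auto
    then have "q = 0" unfolding q_def by (simp add: measure_eq_0_null_sets)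
    then show ?thesis using True by (simp add: p_def q_def)
  next
    case False
    then have p: "p > 0" unfolding p_def by (simp add: zero_less_measure_iff)
    define c where "c = q / p"
    have c: "c \<ge> 0" unfolding c_def q_def p_def by simp
    have p1: "p \<le> 1" "q \<ge> 0" unfolding p_def q_def by auto
    \<comment> \<open>The minorant of \<open>f powr \<alpha>\<close> that is its tangent at \<open>q / p\<close> on the event and its tangent
      at \<open>1\<close> off the event; being affine in \<open>f\<close>, it has an explicit integral.\<close>
    define g where "g x = (c powr \<alpha> - \<alpha> * c powr (\<alpha> - 1) * c) * indicator A x
        + \<alpha> * c powr (\<alpha> - 1) * (f x * indicator A x)
        + (1 - \<alpha>) * indicator (space Q - A) x + \<alpha> * (f x * indicator (space Q - A) x)" for x
    have ind: "integrable Q (\<lambda>x. f x * indicator B x)" if "B \<in> sets Q" for B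
      using integrable_mult_indicator[OF that int_f] by (simp add: mult.commute)
    have ind1: "integrable Q (\<lambda>x. indicator B x :: real)" if "B \<in> sets Q" for B
      using that by (simp add: Q.emeasure_eq_measure)
    have int_g: "integrable Q g"
      unfolding g_def using A ind ind1
      by (intro Bochner_Integration.integrable_add integrable_mult_right) auto
    have "(\<integral>x. g x \<partial>Q) = (c powr \<alpha> - \<alpha> * c powr (\<alpha> - 1) * c) * measure Q A
        + \<alpha> * c powr (\<alpha> - 1) * measure P A
        + (1 - \<alpha>) * measure Q (space Q - A) + \<alpha> * measure P (space Q - A)"
      unfolding g_def using A ind ind1 by (simp add: f_set Int_absorb1 sets.sets_into_space)
    also have "measure P (space Q - A) = 1 - q"
      unfolding q_def using P.prob_compl[of A] A sets_eq sets_eq_imp_space_eq[OF sets_eq] by simp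
    also have "measure Q (space Q - A) = 1 - p"
      unfolding p_def using Q.prob_compl[of A] A by simp
    finally have "(\<integral>x. g x \<partial>Q) = c powr \<alpha> * p - \<alpha> * c powr (\<alpha> - 1) * (c * p - q)
        + (1 - \<alpha>) * (1 - p) + \<alpha> * (1 - q)"
      unfolding p_def[symmetric] q_def[symmetric] by (simp add: algebra_simps)
    moreover have "c * p = q" using p by (simp add: c_def)
    ultimately have "(\<integral>x. g x \<partial>Q) = c powr \<alpha> * p + 1 + (\<alpha> - 1) * p - \<alpha> * q"
      by (simp add: algebra_simps)
    moreover have "(\<integral>x. g x \<partial>Q) \<le> (\<integral>x. f x powr \<alpha> \<partial>Q)"
    proof (rule integral_mono[OF int_g int_f\<alpha>])
      fix x assume "x \<in> space Q"
      then show "g x \<le> f x powr \<alpha>"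
        using powr_above_tangent[OF \<alpha> c f_nonneg[of x]] powr_above_tangent[OF \<alpha> _ f_nonneg[of x], of 1]
        by (auto simp: g_def algebra_simps split: split_indicator)
    qed
    moreover have "(\<alpha> - 1) * p \<ge> 0" using \<alpha> p by simp
    ultimately have *: "c powr \<alpha> * p \<le> exp ((\<alpha> - 1) * \<delta>) - 1 + \<alpha> * q"
      using int_J J_le by linarith
    have "q powr \<alpha> = (c powr \<alpha> * p) * p powr (\<alpha> - 1)"
      using p p1 by (simp add: c_def powr_divide powr_diff)
    also have "\<dots> \<le> (exp ((\<alpha> - 1) * \<delta>) - 1 + \<alpha> * q) * p powr (\<alpha> - 1)"
      using * by (intro mult_right_mono) auto
    finally show ?thesis by (simp add: p_def q_def)
  qed
qed

text \<open>Any probability \<open>q\<close> that satisfies the two-cell inequality is attained by the measure with density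
  \<open>q / p\<close> on the event and \<open>(1 - q) / (1 - p)\<close> on its complement.\<close>

lemma two_valued_density:
  assumes "prob_space Q" and A: "A \<in> sets Q"
    and p: "0 < measure Q A" "measure Q A < 1" and q: "0 \<le> q" "q \<le> 1" and \<alpha>: "\<alpha> > 1"
    and le: "q powr \<alpha> * measure Q A powr (1 - \<alpha>)
      + (1 - q) powr \<alpha> * (1 - measure Q A) powr (1 - \<alpha>) \<le> exp ((\<alpha> - 1) * \<delta>)"
  obtains P where "prob_space P" "sets P = sets Q" "measure P A = q"
    "renyi_divergence \<alpha> P Q \<le> ereal \<delta>"
proof -
  interpret prob_space Q by fact
  note [measurable] = A
  define p where "p = measure Q A"
  have p': "0 < p" "p < 1" using p by (auto simp: p_def)
  define f where "f x = (if x \<in> A then q / p else (1 - q) / (1 - p))" for x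
  have f_meas[measurable]: "f \<in> borel_measurable Q" unfolding f_def by measurable
  have f_nonneg: "f x \<ge> 0" for x using p' q by (simp add: f_def)
  define P where "P = density Q (\<lambda>x. ennreal (f x))"
  have step: "(\<integral>\<^sup>+x. ennreal (if x \<in> A then u else v) \<partial>Q) = ennreal (u * p + v * (1 - p))"
    if "u \<ge> 0" "v \<ge> 0" for u v
  proof -
    have "(\<integral>\<^sup>+x. ennreal (if x \<in> A then u else v) \<partial>Q)
        = (\<integral>\<^sup>+x. ennreal u * indicator A x + ennreal v * indicator (space Q - A) x \<partial>Q)"
      by (intro nn_integral_cong) (auto split: split_indicator)
    also have "\<dots> = ennreal u * emeasure Q A + ennreal v * emeasure Q (space Q - A)"
      by (subst nn_integral_add) (auto simp: nn_integral_cmult_indicator)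
    also have "\<dots> = ennreal (u * p + v * (1 - p))"
      using that p' A by (simp add: emeasure_eq_measure prob_compl p_def ennreal_mult ennreal_plus)
    finally show ?thesis .
  qed
  have "emeasure P (space P) = (\<integral>\<^sup>+x. ennreal (f x) \<partial>Q)"
    unfolding P_def by (simp add: emeasure_density cong: nn_integral_cong)
  also have "\<dots> = 1"
    using step[of "q / p" "(1 - q) / (1 - p)"] p' q unfolding f_def by simp
  finally have P: "prob_space P" by (rule prob_spaceI)
  have "emeasure P A = (\<integral>\<^sup>+x. ennreal (f x) * indicator A x \<partial>Q)"
    unfolding P_def by (rule emeasure_density) auto
  also have "\<dots> = (\<integral>\<^sup>+x. ennreal (if x \<in> A then q / p else 0) \<partial>Q)"
    by (intro nn_integral_cong) (auto simp: f_def)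
  also have "\<dots> = ennreal q" using step[of "q / p" 0] p' q by simp
  finally have PA: "measure P A = q" using q by (simp add: measure_def)
  define E where "E = q powr \<alpha> * p powr (1 - \<alpha>) + (1 - q) powr \<alpha> * (1 - p) powr (1 - \<alpha>)"
  have "(\<integral>\<^sup>+x. ennreal (f x powr \<alpha>) \<partial>Q)
      = (\<integral>\<^sup>+x. ennreal (if x \<in> A then (q / p) powr \<alpha> else ((1 - q) / (1 - p)) powr \<alpha>) \<partial>Q)"
    by (intro nn_integral_cong) (auto simp: f_def)
  also have "\<dots> = ennreal ((q / p) powr \<alpha> * p + ((1 - q) / (1 - p)) powr \<alpha> * (1 - p))"
    by (intro step) auto
  also have "(q / p) powr \<alpha> * p + ((1 - q) / (1 - p)) powr \<alpha> * (1 - p) = E"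
    using p' q by (simp add: E_def powr_divide powr_diff)
  finally have int: "(\<integral>\<^sup>+x. ennreal (f x powr \<alpha>) \<partial>Q) = ennreal E" .
  have E_le: "E \<le> exp ((\<alpha> - 1) * \<delta>)" using le by (simp add: E_def p_def)
  have "E > 0"
  proof (cases "q = 0")
    case True
    then show ?thesis using p' by (simp add: E_def)
  next
    case False
    then have "q powr \<alpha> * p powr (1 - \<alpha>) > 0" using p' by simp
    moreover have "(1 - q) powr \<alpha> * (1 - p) powr (1 - \<alpha>) \<ge> 0" by simp
    ultimately show ?thesis unfolding E_def by linarith
  qed
  then have "ln E \<le> (\<alpha> - 1) * \<delta>" using E_le by (metis ln_exp ln_le_cancel_iff exp_gt_zero)
  then have "1 / (\<alpha> - 1) * ln E \<le> \<delta>" using \<alpha> by (simp add: field_simps)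
  then have "renyi_divergence \<alpha> P Q \<le> ereal \<delta>"
    unfolding P_def using renyi_divergence_density[OF assms(1) f_meas f_nonneg int] \<open>E > 0\<close> by simp
  then show ?thesis using that P PA by (simp add: P_def)
qed

lemma renyi_divergence_self:
  assumes "prob_space Q"
  shows "renyi_divergence \<alpha> Q Q = 0"
proof -
  interpret prob_space Q by fact
  have "renyi_divergence \<alpha> (density Q (\<lambda>x. ennreal 1)) Q = ereal (1 / (\<alpha> - 1) * ln 1)"
    by (rule renyi_divergence_density) (auto simp: assms emeasure_space_1)
  then show ?thesis by (simp add: density_1 zero_ereal_def)
qed

section \<open>Limits of \<open>(1 - s\<^sub>n) ^ n\<close>\<close>

lemma power_one_minus_bounds:
  fixes s :: real
  assumes "0 \<le> s" "s < 1"
  shows "(1 - s) ^ n \<le> exp (- (n * s))" "exp (- (n * s / (1 - s))) \<le> (1 - s) ^ n"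
proof -
  have "1 - s \<le> exp (- s)" using exp_ge_add_one_self[of "- s"] by simp
  then have "(1 - s) ^ n \<le> exp (- s) ^ n" using assms by (intro power_mono) auto
  then show "(1 - s) ^ n \<le> exp (- (n * s))" by (simp add: exp_of_nat_mult[symmetric])
  have "1 / (1 - s) \<le> exp (s / (1 - s))"
    using exp_ge_add_one_self[of "s / (1 - s)"] assms by (simp add: field_simps)
  then have "exp (- (s / (1 - s))) \<le> 1 - s"
    using assms by (simp add: exp_minus field_simps)
  then have "exp (- (s / (1 - s))) ^ n \<le> (1 - s) ^ n" by (intro power_mono) auto
  then show "exp (- (n * s / (1 - s))) \<le> (1 - s) ^ n"
    by (simp add: exp_of_nat_mult[symmetric])
qed

lemma power_one_minus_tendsto_exp:
  fixes s :: "nat \<Rightarrow> real"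
  assumes s: "\<And>n. 0 \<le> s n" and lim: "(\<lambda>n. n * s n) \<longlonglongrightarrow> \<tau>"
  shows "(\<lambda>n. (1 - s n) ^ n) \<longlonglongrightarrow> exp (- \<tau>)"
proof -
  have "(\<lambda>n. (n * s n) * (1 / real n)) \<longlonglongrightarrow> \<tau> * 0"
    by (intro tendsto_mult lim lim_const_over_n)
  moreover have "\<forall>\<^sub>F n in sequentially. (n * s n) * (1 / real n) = s n"
    using eventually_gt_at_top[of 0] by eventually_elim simp
  ultimately have s0: "s \<longlonglongrightarrow> 0" by (simp add: tendsto_cong)
  then have s1: "\<forall>\<^sub>F n in sequentially. s n < 1" by (rule order_tendstoD) simp
  show ?thesis
  proof (rule tendsto_sandwich)
    show "\<forall>\<^sub>F n in sequentially. exp (- (n * s n / (1 - s n))) \<le> (1 - s n) ^ n"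
      using s1 by eventually_elim (intro power_one_minus_bounds s)
    show "\<forall>\<^sub>F n in sequentially. (1 - s n) ^ n \<le> exp (- (n * s n))"
      using s1 by eventually_elim (intro power_one_minus_bounds s)
    have "(\<lambda>n. exp (- (n * s n / (1 - s n)))) \<longlonglongrightarrow> exp (- (\<tau> / (1 - 0)))"
      by (intro tendsto_intros lim s0) simp
    then show "(\<lambda>n. exp (- (n * s n / (1 - s n)))) \<longlonglongrightarrow> exp (- \<tau>)" by simp
    show "(\<lambda>n. exp (- (n * s n))) \<longlonglongrightarrow> exp (- \<tau>)"
      by (intro tendsto_intros lim)
  qed
qed

lemma power_one_minus_tendsto_0:
  fixes s :: "nat \<Rightarrow> real"
  assumes s: "\<And>n. 0 \<le> s n" "\<And>n. s n \<le> 1" and lim: "filterlim (\<lambda>n. n * s n) at_top sequentially"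
  shows "(\<lambda>n. (1 - s n) ^ n) \<longlonglongrightarrow> 0"
proof (rule tendsto_sandwich[OF _ _ tendsto_const])
  show "\<forall>\<^sub>F n in sequentially. (1 - s n) ^ n \<le> exp (- (n * s n))"
    using eventually_gt_at_top[of 0]
  proof eventually_elim
    case (elim n)
    show ?case
    proof (cases "s n = 1")
      case True
      then show ?thesis using elim by (simp add: power_0_left)
    next
      case False
      then show ?thesis using s[of n] by (intro power_one_minus_bounds) auto
    qed
  qed
  show "(\<lambda>n. exp (- (n * s n))) \<longlonglongrightarrow> 0"
    using filterlim_compose[OF exp_at_bot] lim filterlim_uminus_at_top by blast
  show "\<forall>\<^sub>F n in sequentially. 0 \<le> (1 - s n) ^ n"
    using s by simp
qed

lemma power_one_minus_tendsto_expD: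
  fixes s :: "nat \<Rightarrow> real"
  assumes s: "\<And>n. 0 \<le> s n" "\<And>n. s n \<le> 1" and lim: "(\<lambda>n. (1 - s n) ^ n) \<longlonglongrightarrow> exp (- \<tau>)"
  shows "(\<lambda>n. n * s n) \<longlonglongrightarrow> \<tau>"
proof -
  define y where "y n = (1 - s n) ^ n" for n
  have y: "y \<longlonglongrightarrow> exp (- \<tau>)" using lim by (simp add: y_def[abs_def])
  have y0: "\<forall>\<^sub>F n in sequentially. y n > exp (- \<tau> - 1)"
    using y by (rule order_tendstoD) simp
  have s1: "\<forall>\<^sub>F n in sequentially. s n < 1"
    using y0 eventually_gt_at_top[of 0]
  proof eventually_elim
    case (elim n)
    have "s n \<noteq> 1"
    proof
      assume "s n = 1"
      then have "y n = 0" using elim by (simp add: y_def)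
      then show False using elim by (simp add: not_less)
    qed
    then show ?case using s[of n] by simp
  qed
  \<comment> \<open>The bounds on the power, solved for \<open>n * s n\<close>.\<close>
  have lnb: "\<forall>\<^sub>F n in sequentially. n * s n \<le> - ln (y n) \<and> - ln (y n) * (1 - s n) \<le> n * s n"
    using s1 y0
  proof eventually_elim
    case (elim n)
    have pos: "y n > 0" using elim(2) exp_gt_zero[of "- \<tau> - 1"] by linarith
    have "ln (y n) \<le> - (n * s n)"
      using power_one_minus_bounds(1)[OF s(1) elim(1), of n] pos
        ln_le_cancel_iff[of "y n" "exp (- (n * s n))"] by (simp add: y_def)
    moreover have "- (n * s n / (1 - s n)) \<le> ln (y n)"
      using power_one_minus_bounds(2)[OF s(1) elim(1)] pos by (simp add: y_def ln_ge_iff)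
    then have "- ln (y n) * (1 - s n) \<le> n * s n"
      using elim(1) by (simp add: field_simps)
    ultimately show ?case by simp
  qed
  have ln_y: "(\<lambda>n. - ln (y n)) \<longlonglongrightarrow> \<tau>"
    using tendsto_minus[OF tendsto_ln[OF y]] by simp
  have s0: "s \<longlonglongrightarrow> 0"
  proof (rule tendsto_sandwich[OF _ _ tendsto_const])
    have "(\<lambda>n. - ln (y n) * (1 / real n)) \<longlonglongrightarrow> \<tau> * 0"
      by (intro tendsto_mult ln_y lim_const_over_n)
    then show "(\<lambda>n. - ln (y n) * (1 / real n)) \<longlonglongrightarrow> 0" by simp
    show "\<forall>\<^sub>F n in sequentially. s n \<le> - ln (y n) * (1 / real n)"
      using lnb eventually_gt_at_top[of 0] by eventually_elim (simp add: field_simps)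
  qed (use s in auto)
  show ?thesis
  proof (rule tendsto_sandwich)
    have "(\<lambda>n. - ln (y n) * (1 - s n)) \<longlonglongrightarrow> \<tau> * (1 - 0)"
      by (intro tendsto_intros ln_y s0)
    then show "(\<lambda>n. - ln (y n) * (1 - s n)) \<longlonglongrightarrow> \<tau>" by simp
    show "(\<lambda>n. - ln (y n)) \<longlonglongrightarrow> \<tau>" by (fact ln_y)
  qed (use lnb in \<open>auto elim: eventually_mono\<close>)
qed

lemma power_one_minus_tendsto_0D:
  fixes s :: "nat \<Rightarrow> real"
  assumes s: "\<And>n. s n \<le> 1" and lim: "(\<lambda>n. (1 - s n) ^ n) \<longlonglongrightarrow> 0"
  shows "filterlim (\<lambda>n. n * s n) at_top sequentially"
  unfolding filterlim_at_top
proof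
  fix M :: real
  have "(\<lambda>n. (1 + (- M) / real n) ^ n) \<longlonglongrightarrow> exp (- M)"
    by (rule tendsto_exp_limit_sequentially)
  then have "\<forall>\<^sub>F n in sequentially. (1 + (- M) / real n) ^ n > exp (- M) / 2"
    by (rule order_tendstoD) simp
  moreover have "\<forall>\<^sub>F n in sequentially. (1 - s n) ^ n < exp (- M) / 2"
    using lim by (rule order_tendstoD) simp
  moreover have "\<forall>\<^sub>F n in sequentially. real n > \<bar>M\<bar>"
    using filterlim_real_sequentially by (simp add: filterlim_at_top_dense)
  ultimately show "\<forall>\<^sub>F n in sequentially. M \<le> n * s n"
  proof eventually_elim
    case (elim n)
    have "(1 - s n) ^ n < (1 - M / n) ^ n" using elim by simp
    then have "1 - s n < 1 - M / n"
      by (rule power_less_imp_less_base) (use elim in \<open>simp add: field_simps\<close>)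
    then show ?case using elim by (simp add: field_simps)
  qed
qed

text \<open>An integer sequence with \<open>m(n) powr \<beta> \<sim> K n\<close>, namely the integer part of
  \<open>(K n) powr (1 / \<beta>)\<close>.\<close>

lemma index_change:
  fixes K \<beta> :: real
  assumes K: "K > 0" and \<beta>: "\<beta> > 0"
  obtains m :: "nat \<Rightarrow> nat"
  where "filterlim m at_top sequentially" "(\<lambda>n. K * n / m n powr \<beta>) \<longlonglongrightarrow> 1"
proof -
  define t where "t n = (K * real n) powr (1 / \<beta>)" for n :: nat
  define m where "m n = nat \<lfloor>t n\<rfloor>" for n
  have t: "filterlim t at_top sequentially"
    unfolding t_def using K \<beta> by real_asymp
  have m_lim: "filterlim m at_top sequentially"
    unfolding m_def using t
    by (intro filterlim_compose[OF filterlim_nat_sequentially] filterlim_compose[OF filterlim_floor_sequentially])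
  have t0: "\<forall>\<^sub>F n in sequentially. t n > 1"
    using t by (simp add: filterlim_at_top_dense)
  have m_bounds: "\<forall>\<^sub>F n in sequentially. 1 - 1 / t n \<le> m n / t n \<and> m n / t n \<le> 1"
    using t0
  proof eventually_elim
    case (elim n)
    have "real (m n) \<le> t n" "t n - 1 \<le> real (m n)"
      using elim unfolding m_def by linarith+
    then have "(t n - 1) / t n \<le> m n / t n" "m n / t n \<le> t n / t n"
      using elim by (intro divide_right_mono; simp)+
    then show ?case using elim by (simp add: diff_divide_distrib)
  qed
  have "(\<lambda>n. m n / t n) \<longlonglongrightarrow> 1"
  proof (rule tendsto_sandwich)
    have "(\<lambda>n. 1 / t n) \<longlonglongrightarrow> 0"
      using t by (intro tendsto_divide_0[OF tendsto_const] filterlim_at_top_imp_at_infinity)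
    then show "(\<lambda>n. 1 - 1 / t n) \<longlonglongrightarrow> 1" using tendsto_diff[OF tendsto_const] by fastforce
    show "(\<lambda>n. 1 :: real) \<longlonglongrightarrow> 1" by simp
  qed (use m_bounds in \<open>auto elim: eventually_mono\<close>)
  then have "(\<lambda>n. 1 / (m n / t n) powr \<beta>) \<longlonglongrightarrow> 1 / 1 powr \<beta>"
    by (intro tendsto_intros) auto
  moreover have "\<forall>\<^sub>F n in sequentially. 1 / (m n / t n) powr \<beta> = K * n / m n powr \<beta>"
    using t0
  proof eventually_elim
    case (elim n)
    have "t n powr \<beta> = K * n" using K \<beta> by (simp add: t_def powr_powr)
    then show ?case using elim by (simp add: powr_divide)
  qed
  ultimately have "(\<lambda>n. K * n / m n powr \<beta>) \<longlonglongrightarrow> 1" by (simp add: tendsto_cong)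
  then show ?thesis using that m_lim by blast
qed

section \<open>Extreme value distributions\<close>

lemma isCont_gev_cdf: "isCont (gev_cdf \<gamma>) x"
proof -
  consider "\<gamma> = 0" | "\<gamma> < 0" | "\<gamma> > 0" by linarith
  then show ?thesis
  proof cases
    case 1
    then have "gev_cdf \<gamma> = (\<lambda>x. exp (- exp (- x)))" by (simp add: gev_cdf_def fun_eq_iff)
    then show ?thesis by (auto intro!: continuous_intros)
  next
    case 2
    have eq: "gev_cdf \<gamma> = (\<lambda>x. exp (- (max 0 (1 + \<gamma> * x) powr (- 1 / \<gamma>))))"
      using 2 by (auto simp: gev_cdf_def fun_eq_iff max_def)
    have "- 1 / \<gamma> > 0" using 2 by simp
    then show ?thesis unfolding eq isCont_def
      by (intro tendsto_intros tendsto_powr') auto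
  next
    case 3
    define h where "h u = (if u > 0 then exp (- (u powr (- 1 / \<gamma>))) else 0)" for u :: real
    have eq: "gev_cdf \<gamma> = (\<lambda>x. h (1 + \<gamma> * x))"
      using 3 by (auto simp: gev_cdf_def fun_eq_iff h_def)
    have "isCont h u" for u
    proof -
      consider "u < 0" | "u > 0" | "u = 0" by linarith
      then show ?thesis
      proof cases
        case 1
        have "\<forall>\<^sub>F v in nhds u. h v = 0"
          using order_tendstoD(2)[OF tendsto_ident_at[of u UNIV] 1] eventually_nhds_in_open[of "{..<0}" u] 1
          by (auto elim!: eventually_mono simp: h_def)
        then show ?thesis using isCont_cong[of h "\<lambda>_. 0"] by simp
      next
        case 2
        have "\<forall>\<^sub>F v in nhds u. h v = exp (- (v powr (- 1 / \<gamma>)))"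
          using eventually_nhds_in_open[of "{0<..}" u] 2
          by (auto elim!: eventually_mono simp: h_def)
        moreover have "isCont (\<lambda>v. exp (- (v powr (- 1 / \<gamma>)))) u"
          using 2 by (intro continuous_intros) auto
        ultimately show ?thesis by (simp add: isCont_cong)
      next
        case 3
        have "(h \<longlongrightarrow> 0) (at_left 0)"
        proof (rule tendsto_eventually)
          show "\<forall>\<^sub>F v in at_left 0. h v = 0"
            by (simp add: eventually_at_filter h_def)
        qed
        moreover have "(h \<longlongrightarrow> 0) (at_right 0)"
        proof -
          have "((\<lambda>v. exp (- (v powr (- 1 / \<gamma>)))) \<longlongrightarrow> 0) (at_right 0)"
            using \<open>\<gamma> > 0\<close> by real_asymp
          moreover have "\<forall>\<^sub>F v in at_right 0. exp (- (v powr (- 1 / \<gamma>))) = h v"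
            by (simp add: eventually_at_filter h_def)
          ultimately show ?thesis by (simp add: tendsto_cong)
        qed
        ultimately show ?thesis using 3 by (simp add: isCont_def h_def filterlim_split_at)
      qed
    qed
    moreover have "isCont (\<lambda>x. 1 + \<gamma> * x) x" by (intro continuous_intros)
    ultimately show ?thesis unfolding eq using isCont_o2 by blast
  qed
qed

text \<open>The value \<open>exp (- \<tau>)\<close> of an extreme value distribution becomes \<open>exp (- (\<tau> powr \<beta>))\<close> when the
  index is divided, and the argument multiplied, by \<open>\<beta>\<close>. The case of value \<open>0\<close>, where \<open>\<tau>\<close> would be
  infinite, occurs only at or below the left endpoint for \<open>\<gamma> > 0\<close>; value \<open>1\<close> is the case \<open>\<tau> = 0\<close>.\<close>

lemma gev_cdf_cases:
  assumes \<beta>: "\<beta> > 0"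
  obtains "gev_cdf \<gamma> y = 0" "gev_cdf (\<gamma> / \<beta>) (\<beta> * y) = 0"
  | \<tau> where "\<tau> \<ge> 0" "gev_cdf \<gamma> y = exp (- \<tau>)" "gev_cdf (\<gamma> / \<beta>) (\<beta> * y) = exp (- (\<tau> powr \<beta>))"
proof -
  consider "\<gamma> = 0" | "\<gamma> \<noteq> 0" "1 + \<gamma> * y > 0" | "1 + \<gamma> * y \<le> 0" "\<gamma> > 0" | "1 + \<gamma> * y \<le> 0" "\<gamma> < 0"
    by linarith
  then show ?thesis
  proof cases
    case 1
    show ?thesis by (rule that(2)[of "exp (- y)"]) (use 1 in \<open>simp_all add: gev_cdf_def powr_def\<close>)
  next
    case 2
    show ?thesis
      by (rule that(2)[of "(1 + \<gamma> * y) powr (- 1 / \<gamma>)"])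
        (use 2 \<beta> in \<open>simp_all add: gev_cdf_def powr_powr\<close>)
  next
    case 3
    show ?thesis by (rule that(1)) (use 3 \<beta> in \<open>simp_all add: gev_cdf_def zero_less_divide_iff\<close>)
  next
    case 4
    show ?thesis
      by (rule that(2)[of 0]) (use 4 \<beta> in \<open>simp_all add: gev_cdf_def zero_less_divide_iff\<close>)
  qed
qed

section \<open>The worst-case tail and its domain of attraction\<close>

text \<open>A reference distribution \<open>Q\<close> on the real line together with the degree and the radius of the Renyi
  ball over which the tail probability is maximised.\<close>

locale renyi_worst_case = real_distribution Q for Q :: "real measure" +
  fixes \<alpha> \<delta> :: real
  assumes \<alpha>: "\<alpha> > 1" and \<delta>: "\<delta> > 0"
begin

text \<open>The bound on the \<open>\<alpha>\<close>-th moment of the density that, for a measure absolutely continuous with respect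
  to \<open>Q\<close>, is equivalent to divergence at most \<open>\<delta>\<close>.\<close>

definition C :: real where "C = exp ((\<alpha> - 1) * \<delta>)"

text \<open>The exponent in the asymptotic relation \<open>W x \<sim> K * tail x powr \<beta>\<close>.\<close>

definition \<beta> :: real where "\<beta> = (\<alpha> - 1) / \<alpha>"

text \<open>The constant in the asymptotic relation \<open>W x \<sim> K * tail x powr \<beta>\<close>.\<close>

definition K :: real where "K = (C - 1) powr (1 / \<alpha>)"

abbreviation tail :: "real \<Rightarrow> real" where "tail x \<equiv> measure Q {x<..}"

abbreviation W :: "real \<Rightarrow> real" where "W \<equiv> worst_case_tail Q \<alpha> \<delta>"

lemma C_gt_1: "C > 1"
  unfolding C_def using \<alpha> \<delta> by simp

lemma K_pos: "K > 0"
  unfolding K_def using C_gt_1 by simp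

lemma \<beta>_pos: "\<beta> > 0" and \<beta>_less_1: "\<beta> < 1"
  unfolding \<beta>_def using \<alpha> by auto

lemma tail_eq: "tail x = 1 - cdf Q x"
proof -
  have "{x<..} = space Q - {..x}" by auto
  then show ?thesis by (simp only: cdf_def) (subst prob_compl, auto)
qed

lemma W_upperI:
  assumes "real_distribution P" "renyi_divergence \<alpha> P Q \<le> ereal \<delta>"
  shows "measure P {x<..} \<le> W x"
  unfolding worst_case_tail_def
proof (rule cSup_upper)
  show "bdd_above {measure P {x<..} | P.
      real_distribution P \<and> renyi_divergence \<alpha> P Q \<le> ereal \<delta>}"
    by (rule bdd_aboveI[of _ 1])
      (auto intro!: prob_space.prob_le_1 real_distribution.axioms(1))
qed (use assms in blast)

lemma self_feasible: "renyi_divergence \<alpha> Q Q \<le> ereal \<delta>"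
  using renyi_divergence_self[OF prob_space_axioms] \<delta> by simp

lemma feasible_nonempty:
  "{measure P {x<..} | P. real_distribution P \<and> renyi_divergence \<alpha> P Q \<le> ereal \<delta>} \<noteq> {}"
  using self_feasible real_distribution_axioms by blast

lemma W_leI:
  assumes "\<And>P. real_distribution P \<Longrightarrow> renyi_divergence \<alpha> P Q \<le> ereal \<delta> \<Longrightarrow> measure P {x<..} \<le> u"
  shows "W x \<le> u"
  unfolding worst_case_tail_def using feasible_nonempty by (rule cSup_least) (use assms in blast)

lemma less_WE:
  assumes "u < W x"
  obtains P where "real_distribution P" "renyi_divergence \<alpha> P Q \<le> ereal \<delta>" "u < measure P {x<..}"
  using assms W_leI[of x u] by (meson not_le)

lemma tail_le_W: "tail x \<le> W x"
  using W_upperI[OF real_distribution_axioms self_feasible] .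

lemma W_nonneg: "0 \<le> W x"
  using tail_le_W[of x] measure_nonneg order_trans by blast

lemma W_le_1: "W x \<le> 1"
  by (rule W_leI) (auto intro!: prob_space.prob_le_1 real_distribution.axioms(1))

lemma W_antimono: "x \<le> y \<Longrightarrow> W y \<le> W x"
proof (rule W_leI)
  fix P assume "x \<le> y" and P: "real_distribution P" "renyi_divergence \<alpha> P Q \<le> ereal \<delta>"
  interpret P: real_distribution P by fact
  have "measure P {y<..} \<le> measure P {x<..}"
    using \<open>x \<le> y\<close> by (intro P.finite_measure_mono) auto
  then show "measure P {y<..} \<le> W x" using W_upperI[OF P] by (rule order_trans)
qed

text \<open>Each admissible tail function is right-continuous, so their supremum is lower semicontinuous from
  the right; monotonicity supplies the other inequality.\<close>

lemma W_right_continuous: "continuous (at_right x) W"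
  unfolding continuous_within
proof (rule order_tendstoI)
  fix u assume "u < W x"
  then obtain P where P: "real_distribution P" "renyi_divergence \<alpha> P Q \<le> ereal \<delta>"
    "u < measure P {x<..}"
    by (rule less_WE)
  interpret P: renyi_worst_case P \<alpha> \<delta>
    using P(1) \<alpha> \<delta> by (simp add: renyi_worst_case_def renyi_worst_case_axioms_def)
  have "((\<lambda>y. 1 - cdf P y) \<longlongrightarrow> 1 - cdf P x) (at_right x)"
    using P.cdf_is_right_cont[of x] by (intro tendsto_intros) (simp add: continuous_within)
  then have "\<forall>\<^sub>F y in at_right x. u < 1 - cdf P y"
    by (rule order_tendstoD) (use P(3) P.tail_eq in simp)
  then show "\<forall>\<^sub>F y in at_right x. u < W y"
    using W_upperI[OF P(1,2)] P.tail_eq by (auto elim!: eventually_mono intro: less_le_trans)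
next
  fix u assume "W x < u"
  moreover have "\<forall>\<^sub>F y in at_right x. W y \<le> W x"
    by (auto simp: eventually_at_filter intro!: W_antimono always_eventually)
  ultimately show "\<forall>\<^sub>F y in at_right x. W y < u"
    by (auto elim!: eventually_mono)
qed

text \<open>The a priori bound \<open>v\<close> is inserted into the right-hand side of the event bound. Taking \<open>v = 1\<close>
  shows that \<open>W\<close> is of order \<open>tail powr \<beta>\<close>; taking \<open>v = W x\<close>, now known to be small, yields the
  sharp constant.\<close>

lemma feasible_le:
  assumes "real_distribution P" "renyi_divergence \<alpha> P Q \<le> ereal \<delta>" "measure P {x<..} \<le> v"
  shows "measure P {x<..} \<le> (C - 1 + \<alpha> * v) powr (1 / \<alpha>) * tail x powr \<beta>"
proof -
  interpret P: real_distribution P by fact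
  let ?q = "measure P {x<..}"
  have "?q powr \<alpha> \<le> (C - 1 + \<alpha> * ?q) * tail x powr (\<alpha> - 1)"
    unfolding C_def
    by (rule renyi_divergence_le_imp_event_bound)
      (use assms \<alpha> prob_space_axioms P.prob_space_axioms in auto)
  also have "\<dots> \<le> (C - 1 + \<alpha> * v) * tail x powr (\<alpha> - 1)"
    using assms(3) \<alpha> by (intro mult_right_mono) auto
  finally have "(?q powr \<alpha>) powr (1 / \<alpha>)
      \<le> ((C - 1 + \<alpha> * v) * tail x powr (\<alpha> - 1)) powr (1 / \<alpha>)"
    using \<alpha> by (intro powr_mono2) auto
  moreover have "0 \<le> v" using assms(3) measure_nonneg order_trans by blast
  then have "0 \<le> C - 1 + \<alpha> * v" using C_gt_1 \<alpha> by simp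
  ultimately show ?thesis
    using \<alpha> by (simp add: powr_powr powr_mult \<beta>_def)
qed

lemma W_le_power: "W x \<le> (C - 1 + \<alpha>) powr (1 / \<alpha>) * tail x powr \<beta>"
  by (rule W_leI, rule order_trans[OF feasible_le[where v = 1]])
    (auto intro!: prob_space.prob_le_1 real_distribution.axioms(1))

lemma W_le_sharp: "W x \<le> (C - 1 + \<alpha> * W x) powr (1 / \<alpha>) * tail x powr \<beta>"
  by (rule W_leI, rule feasible_le[OF _ _ W_upperI])

text \<open>The two-valued density with \<open>q\<close> as large as the constraint permits once \<open>(1 - q) powr \<alpha>\<close> is
  bounded by \<open>1\<close>. The smallness assumptions ensure that \<open>q\<close> lies between \<open>0\<close> and \<open>1\<close>.\<close>

lemma W_ge_sharp:
  assumes t: "0 < tail x" "tail x < 1"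
    and small: "(1 - tail x) powr (1 - \<alpha>) \<le> C" "K * tail x powr \<beta> \<le> 1"
  shows "(C - (1 - tail x) powr (1 - \<alpha>)) powr (1 / \<alpha>) * tail x powr \<beta> \<le> W x"
proof -
  define p where "p = tail x"
  define d where "d = C - (1 - p) powr (1 - \<alpha>)"
  define q where "q = d powr (1 / \<alpha>) * p powr \<beta>"
  have p: "0 < p" "p < 1" using t by (auto simp: p_def)
  have d0: "d \<ge> 0" using small by (simp add: d_def p_def)
  have "(1 - p) powr (1 - \<alpha>) \<ge> (1 - p) powr 0"
    using p \<alpha> by (intro powr_mono') auto
  then have d1: "d \<le> C - 1" using p by (simp add: d_def)
  have q0: "q \<ge> 0" by (simp add: q_def)
  have "q \<le> K * p powr \<beta>"
    unfolding q_def K_def using d0 d1 \<alpha> by (intro mult_right_mono powr_mono2) auto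
  then have q1: "q \<le> 1" using small by (simp add: p_def)
  have \<beta>\<alpha>: "\<beta> * \<alpha> = \<alpha> - 1" using \<alpha> by (simp add: \<beta>_def)
  have "q powr \<alpha> * p powr (1 - \<alpha>) = d * (p powr (\<alpha> - 1) * p powr (1 - \<alpha>))"
    using d0 p \<alpha> by (simp add: q_def powr_mult powr_powr \<beta>\<alpha>)
  also have "\<dots> = d" using p by (simp flip: powr_add)
  finally have e1: "q powr \<alpha> * p powr (1 - \<alpha>) = d" .
  have "(1 - q) powr \<alpha> \<le> 1"
    using q0 q1 \<alpha> powr_mono2[of \<alpha> "1 - q" 1] by simp
  then have "(1 - q) powr \<alpha> * (1 - p) powr (1 - \<alpha>) \<le> 1 * (1 - p) powr (1 - \<alpha>)"
    by (intro mult_right_mono) auto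
  with e1 have "q powr \<alpha> * p powr (1 - \<alpha>) + (1 - q) powr \<alpha> * (1 - p) powr (1 - \<alpha>) \<le> C"
    by (simp add: d_def)
  then obtain P where P: "prob_space P" "sets P = sets Q" "measure P {x<..} = q"
    "renyi_divergence \<alpha> P Q \<le> ereal \<delta>"
    using two_valued_density[of Q "{x<..}" q \<alpha> \<delta>] prob_space_axioms t q0 q1 \<alpha>
    unfolding p_def C_def by auto
  then have "real_distribution P"
    by (simp add: real_distribution_def real_distribution_axioms_def)
  then show ?thesis using W_upperI[OF _ P(4), of x] P(3) by (simp add: q_def d_def p_def)
qed

text \<open>The quotient of the worst-case tail by \<open>tail powr \<beta>\<close>. Where the tail vanishes so does \<open>W\<close>, and any
  value would do; with the value \<open>K\<close> the convergence to \<open>K\<close> needs no positivity of the tail.\<close>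

definition ratio :: "real \<Rightarrow> real" where
  "ratio x = (if tail x = 0 then K else W x / tail x powr \<beta>)"

lemma W_eq_ratio: "W x = ratio x * tail x powr \<beta>"
proof (cases "tail x = 0")
  case True
  then have "W x \<le> 0" using W_le_power[of x] by simp
  then show ?thesis using True W_nonneg[of x] by simp
qed (simp add: ratio_def)

lemma tendsto_ratio:
  assumes t: "((\<lambda>n. tail (X n)) \<longlongrightarrow> 0) G"
  shows "((\<lambda>n. ratio (X n)) \<longlongrightarrow> K) G"
proof (rule tendsto_sandwich[where f = "\<lambda>n. (C - (1 - tail (X n)) powr (1 - \<alpha>)) powr (1 / \<alpha>)"
      and h = "\<lambda>n. (C - 1 + \<alpha> * W (X n)) powr (1 / \<alpha>)"])
  have t\<beta>: "((\<lambda>n. tail (X n) powr \<beta>) \<longlongrightarrow> 0) G"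
    using tendsto_powr'[OF t tendsto_const[of \<beta>]] \<beta>_pos by simp
  have W0: "((\<lambda>n. W (X n)) \<longlongrightarrow> 0) G"
  proof (rule tendsto_sandwich[OF _ _ tendsto_const])
    show "((\<lambda>n. (C - 1 + \<alpha>) powr (1 / \<alpha>) * tail (X n) powr \<beta>) \<longlongrightarrow> 0) G"
      using tendsto_mult[OF tendsto_const t\<beta>] by simp
  qed (auto simp: W_nonneg W_le_power)
  have "((\<lambda>n. (C - 1 + \<alpha> * W (X n)) powr (1 / \<alpha>)) \<longlongrightarrow> (C - 1 + \<alpha> * 0) powr (1 / \<alpha>)) G"
    using C_gt_1 by (intro tendsto_intros W0) auto
  then show "((\<lambda>n. (C - 1 + \<alpha> * W (X n)) powr (1 / \<alpha>)) \<longlongrightarrow> K) G"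
    by (simp add: K_def)
  have "C - 1 + \<alpha> * W x \<ge> C - 1" for x
    using \<alpha> W_nonneg[of x] by simp
  then have "K \<le> (C - 1 + \<alpha> * W x) powr (1 / \<alpha>)" for x
    unfolding K_def using \<alpha> C_gt_1 by (intro powr_mono2) auto
  then have "ratio x \<le> (C - 1 + \<alpha> * W x) powr (1 / \<alpha>)" for x
    using W_le_sharp[of x] by (auto simp: ratio_def field_simps zero_less_measure_iff)
  then show "\<forall>\<^sub>F n in G. ratio (X n) \<le> (C - 1 + \<alpha> * W (X n)) powr (1 / \<alpha>)"
    by simp
  have t1: "((\<lambda>n. (1 - tail (X n)) powr (1 - \<alpha>)) \<longlongrightarrow> 1) G"
    using tendsto_powr[OF tendsto_diff[OF tendsto_const t, of 1] tendsto_const[of "1 - \<alpha>"]] by simp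
  have "((\<lambda>n. (C - (1 - tail (X n)) powr (1 - \<alpha>)) powr (1 / \<alpha>)) \<longlongrightarrow> (C - 1) powr (1 / \<alpha>)) G"
    using C_gt_1 by (intro tendsto_intros t1) auto
  then show "((\<lambda>n. (C - (1 - tail (X n)) powr (1 - \<alpha>)) powr (1 / \<alpha>)) \<longlongrightarrow> K) G"
    by (simp add: K_def)
  have "\<forall>\<^sub>F n in G. tail (X n) < 1" using t by (rule order_tendstoD) simp
  moreover have "\<forall>\<^sub>F n in G. (1 - tail (X n)) powr (1 - \<alpha>) < C"
    using t1 by (rule order_tendstoD) (use C_gt_1 in simp)
  moreover have "((\<lambda>n. K * tail (X n) powr \<beta>) \<longlongrightarrow> 0) G"
    using tendsto_mult[OF tendsto_const t\<beta>] by simp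
  then have "\<forall>\<^sub>F n in G. K * tail (X n) powr \<beta> < 1" by (rule order_tendstoD) simp
  ultimately show "\<forall>\<^sub>F n in G. (C - (1 - tail (X n)) powr (1 - \<alpha>)) powr (1 / \<alpha>) \<le> ratio (X n)"
  proof eventually_elim
    case (elim n)
    show ?case
    proof (cases "tail (X n) = 0")
      case True
      then show ?thesis by (simp add: ratio_def K_def)
    next
      case False
      then have "tail (X n) > 0" by (simp add: zero_less_measure_iff)
      then show ?thesis
        using W_ge_sharp[of "X n"] elim by (simp add: ratio_def field_simps)
    qed
  qed
qed

text \<open>A lower bound of the right order without smallness of the tail, needed where the limiting
  distribution function vanishes and the tail need not tend to \<open>0\<close>.\<close>

lemma W_ge_power:
  obtains c where "c > 0" "\<And>x. c * tail x powr \<beta> \<le> W x"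
proof -
  \<comment> \<open>Along this filter the tail tends to \<open>0\<close>, so the limit of the ratio becomes a bound on
    \<open>{x. tail x < e}\<close>; elsewhere \<open>W \<ge> tail \<ge> e\<close>.\<close>
  let ?G = "filtercomap tail (nhds 0)"
  have "(ratio \<longlongrightarrow> K) ?G"
    by (rule tendsto_ratio) (rule filterlim_filtercomap)
  then have "\<forall>\<^sub>F x in ?G. ratio x > K / 2"
    by (rule order_tendstoD) (use K_pos in simp)
  then obtain R where R: "eventually R (nhds 0)" "\<And>x. R (tail x) \<Longrightarrow> ratio x > K / 2"
    by (auto simp: eventually_filtercomap)
  then obtain e where e: "e > 0" "\<And>t. \<bar>t\<bar> < e \<Longrightarrow> R t"
    by (auto simp: eventually_nhds_metric dist_real_def)
  show ?thesis
  proof (rule that)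
    show "min (K / 2) e > 0" using K_pos e by simp
    fix x
    show "min (K / 2) e * tail x powr \<beta> \<le> W x"
    proof (cases "tail x < e")
      case True
      then have "ratio x > K / 2" using R(2) e(2) by simp
      then show ?thesis unfolding W_eq_ratio by (intro mult_right_mono) auto
    next
      case False
      have "tail x powr \<beta> \<le> 1"
        using powr_mono2[of \<beta> "tail x" 1] \<beta>_pos by simp
      then have "min (K / 2) e * tail x powr \<beta> \<le> e * 1"
        using e K_pos by (intro mult_mono) auto
      also have "\<dots> \<le> W x" using False tail_le_W[of x] by simp
      finally show ?thesis .
    qed
  qed
qed

lemma worst_case_cdf: "\<exists>M. real_distribution M \<and> (\<lambda>x. 1 - W x) = cdf M"
proof -
  have mono: "1 - W x \<le> 1 - W y" if "x \<le> y" for x y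
    using W_antimono[OF that] by simp
  have cont: "continuous (at_right a) (\<lambda>x. 1 - W x)" for a
    using W_right_continuous by (intro continuous_intros)
  have tail_bot: "(tail \<longlongrightarrow> 1) at_bot" and tail_top: "(tail \<longlongrightarrow> 0) at_top"
    using tendsto_diff[OF tendsto_const cdf_lim_at_bot, of 1]
      tendsto_diff[OF tendsto_const cdf_lim_at_top_prob, of 1]
    by (simp_all add: tail_eq[abs_def])
  have bot: "((\<lambda>x. 1 - W x) \<longlongrightarrow> 0) at_bot"
  proof -
    have "(W \<longlongrightarrow> 1) at_bot"
      by (rule tendsto_sandwich[OF _ _ tail_bot tendsto_const]) (auto simp: tail_le_W W_le_1)
    then show ?thesis using tendsto_diff[OF tendsto_const, of W 1 at_bot 1] by simp
  qed
  have top: "((\<lambda>x. 1 - W x) \<longlongrightarrow> 1) at_top"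
  proof -
    have "((\<lambda>x. ratio x * tail x powr \<beta>) \<longlongrightarrow> K * 0 powr \<beta>) at_top"
      using \<beta>_pos by (intro tendsto_mult tendsto_ratio tendsto_powr' tail_top tendsto_const) auto
    then have "(W \<longlongrightarrow> 0) at_top" by (simp add: W_eq_ratio[symmetric])
    then show ?thesis using tendsto_diff[OF tendsto_const, of W 0 at_top 1] by simp
  qed
  show ?thesis
    using real_distribution_interval_measure[OF mono cont bot top] cdf_interval_measure[OF mono cont bot]
    by metis
qed

lemma worst_case_powers_tendsto:
  assumes m: "filterlim m at_top sequentially" "(\<lambda>n. K * n / m n powr \<beta>) \<longlonglongrightarrow> 1"
    and lim: "(\<lambda>k. cdf Q (X k) ^ k) \<longlonglongrightarrow> gev_cdf \<gamma> y"
  shows "(\<lambda>n. (1 - W (X (m n))) ^ n) \<longlonglongrightarrow> gev_cdf (\<gamma> / \<beta>) (\<beta> * y)"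
proof -
  define p where "p n = tail (X (m n))" for n
  define \<rho> where "\<rho> n = K * n / m n powr \<beta>" for n
  have \<rho>: "\<rho> \<longlonglongrightarrow> 1" using m(2) by (simp add: \<rho>_def[abs_def])
  have cdf_eq: "cdf Q x = 1 - tail x" for x by (simp add: tail_eq)
  have lim': "(\<lambda>k. (1 - tail (X k)) ^ k) \<longlonglongrightarrow> gev_cdf \<gamma> y"
    using lim by (simp add: cdf_eq)
  have p01: "0 \<le> p n" "p n \<le> 1" for n by (simp_all add: p_def)
  have mpos: "\<forall>\<^sub>F n in sequentially. m n > 0"
    using filterlim_at_top[THEN iffD1, OF m(1), rule_format, of 1] by eventually_elim simp
  have scale: "\<forall>\<^sub>F n in sequentially. n * p n powr \<beta> = \<rho> n / K * (m n * p n) powr \<beta>"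
    using mpos
  proof eventually_elim
    case (elim n)
    then show ?case using K_pos p01[of n] by (simp add: \<rho>_def powr_mult)
  qed
  show ?thesis
  proof (rule gev_cdf_cases[OF \<beta>_pos, of \<gamma> y])
    assume "gev_cdf \<gamma> y = 0" and goal0: "gev_cdf (\<gamma> / \<beta>) (\<beta> * y) = 0"
    then have "filterlim (\<lambda>k. k * tail (X k)) at_top sequentially"
      using lim' by (intro power_one_minus_tendsto_0D) auto
    then have "filterlim (\<lambda>n. m n * p n) at_top sequentially"
      unfolding p_def by (rule filterlim_compose) (rule m(1))
    moreover have "filterlim (\<lambda>u::real. u powr \<beta>) at_top at_top"
      using \<beta>_pos by real_asymp
    ultimately have mp: "filterlim (\<lambda>n. (m n * p n) powr \<beta>) at_top sequentially"
      by (rule filterlim_compose[rotated])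
    obtain c where c: "c > 0" "\<And>x. c * tail x powr \<beta> \<le> W x"
      using W_ge_power by blast
    have "(\<lambda>n. c * (\<rho> n / K)) \<longlonglongrightarrow> c * (1 / K)"
      using K_pos by (intro tendsto_intros \<rho>) simp
    then have "filterlim (\<lambda>n. c * (\<rho> n / K) * (m n * p n) powr \<beta>) at_top sequentially"
      by (rule filterlim_tendsto_pos_mult_at_top) (use c K_pos mp in auto)
    then have "filterlim (\<lambda>n. n * W (X (m n))) at_top sequentially"
    proof (rule filterlim_at_top_mono)
      show "\<forall>\<^sub>F n in sequentially. c * (\<rho> n / K) * (m n * p n) powr \<beta> \<le> n * W (X (m n))"
        using scale
      proof eventually_elim
        case (elim n)
        have "c * (\<rho> n / K) * (m n * p n) powr \<beta> = c * (n * p n powr \<beta>)"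
          unfolding elim by (rule mult.assoc)
        also have "\<dots> = n * (c * p n powr \<beta>)" by (rule mult.left_commute)
        also have "\<dots> \<le> n * W (X (m n))"
          using c(2) unfolding p_def by (intro mult_left_mono) auto
        finally show ?case .
      qed
    qed
    then show ?thesis
      unfolding goal0 by (intro power_one_minus_tendsto_0 W_nonneg W_le_1)
  next
    fix \<tau> :: real
    assume \<tau>: "\<tau> \<ge> 0" "gev_cdf \<gamma> y = exp (- \<tau>)"
      and goal\<tau>: "gev_cdf (\<gamma> / \<beta>) (\<beta> * y) = exp (- (\<tau> powr \<beta>))"
    have "(\<lambda>k. k * tail (X k)) \<longlonglongrightarrow> \<tau>"
      using lim' \<tau> by (intro power_one_minus_tendsto_expD) auto
    then have mp: "(\<lambda>n. m n * p n) \<longlonglongrightarrow> \<tau>"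
      unfolding p_def by (rule filterlim_compose) (rule m(1))
    have "(\<lambda>n. (m n * p n) * (1 / real (m n))) \<longlonglongrightarrow> \<tau> * 0"
      using filterlim_compose[OF lim_const_over_n m(1), of 1] by (intro tendsto_mult mp)
    moreover have "\<forall>\<^sub>F n in sequentially. (m n * p n) * (1 / real (m n)) = p n"
      using mpos by eventually_elim simp
    ultimately have "p \<longlonglongrightarrow> 0" by (simp add: tendsto_cong)
    then have r: "(\<lambda>n. ratio (X (m n))) \<longlonglongrightarrow> K"
      unfolding p_def by (rule tendsto_ratio)
    have "(\<lambda>n. ratio (X (m n)) * (\<rho> n / K * (m n * p n) powr \<beta>)) \<longlonglongrightarrow> K * (1 / K * \<tau> powr \<beta>)"
      using K_pos \<beta>_pos p01 by (intro tendsto_mult tendsto_divide r \<rho> tendsto_const tendsto_powr' mp) auto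
    moreover have "\<forall>\<^sub>F n in sequentially.
        ratio (X (m n)) * (\<rho> n / K * (m n * p n) powr \<beta>) = n * W (X (m n))"
      using scale
    proof eventually_elim
      case (elim n)
      have "n * W (X (m n)) = ratio (X (m n)) * (n * p n powr \<beta>)"
        unfolding p_def by (subst W_eq_ratio) simp
      then show ?case using elim by simp
    qed
    ultimately have "(\<lambda>n. n * W (X (m n))) \<longlonglongrightarrow> \<tau> powr \<beta>"
      using K_pos by (simp add: tendsto_cong)
    then show ?thesis
      unfolding goal\<tau> by (intro power_one_minus_tendsto_exp W_nonneg)
  qed
qed

lemma worst_case_max_domain:
  assumes "cdf Q \<in> max_domain_of_attraction \<gamma>"
  shows "(\<lambda>x. 1 - W x) \<in> max_domain_of_attraction (\<gamma> / \<beta>)"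
proof -
  obtain a b a' b' where pos: "\<And>n::nat. a n > 0" "a' > 0"
    and lim: "\<And>x. isCont (\<lambda>t. gev_cdf \<gamma> (a' * t + b')) x \<Longrightarrow>
      (\<lambda>n. cdf Q (a n * x + b n) ^ n) \<longlonglongrightarrow> gev_cdf \<gamma> (a' * x + b')"
    using assms unfolding max_domain_of_attraction_def by blast
  obtain m :: "nat \<Rightarrow> nat" where m: "filterlim m at_top sequentially"
    "(\<lambda>n. K * n / m n powr \<beta>) \<longlonglongrightarrow> 1"
    using index_change[OF K_pos \<beta>_pos] .
  have lim': "(\<lambda>n. (1 - W (a (m n) * x + b (m n))) ^ n)
      \<longlonglongrightarrow> gev_cdf (\<gamma> / \<beta>) ((\<beta> * a') * x + \<beta> * b')" for x
  proof -
    have "isCont (\<lambda>t. a' * t + b') x" by (intro continuous_intros)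
    then have "isCont (\<lambda>t. gev_cdf \<gamma> (a' * t + b')) x"
      using isCont_gev_cdf isCont_o2 by blast
    from worst_case_powers_tendsto[OF m lim[OF this]] show ?thesis
      by (simp add: algebra_simps)
  qed
  show ?thesis
    unfolding max_domain_of_attraction_def mem_Collect_eq
  proof (intro conjI exI allI impI)
    show "real_distribution (SOME M. real_distribution M \<and> (\<lambda>x. 1 - W x) = cdf M)"
      "(\<lambda>x. 1 - W x) = cdf (SOME M. real_distribution M \<and> (\<lambda>x. 1 - W x) = cdf M)"
      using someI_ex[OF worst_case_cdf] by blast+
    show "a (m n) > 0" for n by (rule pos)
    show "\<beta> * a' > 0" using pos \<beta>_pos by simp
    show "(\<lambda>n. (1 - W (a (m n) * x + b (m n))) ^ n)
        \<longlonglongrightarrow> gev_cdf (\<gamma> / \<beta>) ((\<beta> * a') * x + \<beta> * b')" for x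
      by (rule lim')
  qed
qed

end

theorem theorem6:
  fixes \<gamma>ref \<alpha> \<delta> \<gamma>star :: real
    and Pref :: "real measure"
    and F :: "real \<Rightarrow> real"
    and xF :: ereal
  assumes "real_distribution Pref"
    and F: "F = cdf Pref"
    and xF: "xF = right_endpoint F"
    and standing: "((\<lambda>x. measure Pref {x<..}) \<longlongrightarrow> 0)
      (left_of (Sup (ereal ` {x. measure Pref {x<..} > 0})))"
    and mda: "F \<in> max_domain_of_attraction \<gamma>ref"
    and smooth: "\<forall>\<^sub>F x in left_of xF.
      F differentiable (at x) \<and> deriv F differentiable (at x) \<and> deriv F x > 0"
    and von_mises: "(deriv (\<lambda>x. (1 - F x) / deriv F x) \<longlongrightarrow> \<gamma>ref) (left_of xF)"
    and "\<alpha> > 1"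
    and "\<delta> > 0"
    and \<gamma>star: "\<gamma>star = \<alpha> / (\<alpha> - 1) * \<gamma>ref"
  shows "(\<lambda>x. 1 - worst_case_tail Pref \<alpha> \<delta> x) \<in> max_domain_of_attraction \<gamma>star"
proof -
  interpret real_distribution Pref by fact
  interpret renyi_worst_case Pref \<alpha> \<delta>
    by unfold_locales fact+
  have "\<gamma>star = \<gamma>ref / \<beta>" by (simp add: \<gamma>star \<beta>_def)
  then show ?thesis using worst_case_max_domain mda F by simp
qed

end
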